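(* Let $\mathbb{K}=\mathbb{R}$ or $\mathbb{C}$, let a scalar product (bilinear or sesquilinear) on $\mathbb{K}^n$ be defined by a nonsingular matrix $N\in\mathbb{K}^{n\times n}$, and let $\sigma:\mathbb{K}^{n\times n}\to\mathbb{K}^{n\times n}$ be a generalized matrix sign function. A matrix $F\in\mathbb{K}^{n\times n}$ has a decomposition $$F=WS,$$ where, with $\Sigma=\sigma(F^{[N]}F)$, the matrix $W\in\mathbb{K}^{n\times n}$ is $(N,N\Sigma^{-1})$-unitary with $(W^{[N]})^{[N]}=W$ and the matrix $S\in\mathbb{K}^{n\times n}$ is $r$-positive-definite, $N$-selfadjoint and $N\Sigma$-selfadjoint, if and only if $F$ is nonsingular and $(F^{[N]})^{[N]}=F$. When such a decomposition exists it is unique, with $S$ given by $S=(\Sigma F^{[N]}F)^{1/2}$ (principal square root) and $W=FS^{-1}$.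
   Context: Notation. $A^\#=A^T$ if the scalar product is a (real or complex) bilinear form $[x,y]_N=x^TNy$, and $A^\#=\bar A^T$ if it is a sesquilinear form $[x,y]_N=\bar x^TNy$; the same choice is used throughout. For $A\in\mathbb{K}^{n\times n}$ and nonsingular $N\in\mathbb{K}^{n\times n}$, $A^{[N]}=N^{-1}A^\# N$, and $A$ is $N$-selfadjoint if $A^{[N]}=A$, i.e. $A^\# N=NA$ (the same definition is used with $N$ replaced by any nonsingular matrix, e.g. $N\Sigma$). For nonsingular $M,N\in\mathbb{K}^{n\times n}$, put $A^{[M,N]}=N^{-1}A^\# M$. A matrix $W\in\mathbb{K}^{n\times n}$ is $(M,N)$-unitary if $W^{[M,N]}W=I_n$ and $WW^{[M,N]}=I_n$ (for square matrices these two conditions are equivalent, and equivalent to $W^\# MW=N$). Thus $W$ is $(N,N\Sigma^{-1})$-unitary iff $W^\# NW=N\Sigma^{-1}$. A square matrix is $r$-positive-definite if all of its eigenvalues have positive real part. For a matrix $A$ with no eigenvalues in $(-\infty,0]$, $A^{1/2}$ is the principal square root: the unique square root of $A$ whose eigenvalues all lie in the open right half-plane. Primary matrix functions. A stem function $f$ assigns to each $\lambda$ in its domain in $\mathbb{C}$ a value $f(\lambda)=f^{(0)}(\lambda)$ and "derivative" values $f^{(j)}(\lambda)$, $j\ge1$, which may be arbitrarily assigned numbers at each $\lambda$. The associated primary matrix function is $f(A)=Qf(J)Q^{-1}$, where $A=QJQ^{-1}$ is a (complex) Jordan decomposition and $f$ is applied to each Jordan block: $f(J_s(\lambda))$ is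 the $s\times s$ upper triangular Toeplitz matrix with $f^{(j)}(\lambda)/j!$ on the $j$-th superdiagonal, $0\le j\le s-1$. A generalized matrix sign function $\sigma:\mathbb{K}^{n\times n}\to\mathbb{K}^{n\times n}$ is a primary matrix function such that for all nonsingular $A\in\mathbb{K}^{n\times n}$: $\sigma(A)A$ has no eigenvalues on the negative real axis, $\sigma(\bar A)=\overline{\sigma(A)}$, and all eigenvalues $\lambda$ of $\sigma(A)$ satisfy $|\lambda|=1$. Such $\sigma$ is defined on nonsingular matrices only (the stem function is left undefined at $0$); any statement that a decomposition involving $\Sigma=\sigma(\cdot)$ exists includes that $\Sigma$ is defined. *)

theory Defs
  imports "Jordan_Normal_Form.Jordan_Normal_Form_Existence"
begin

text \<open>
  The field is represented by the set \<open>K\<close> of its elements inside the complex numbers, so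
  \<open>K = \<real>\<close> or \<open>K = UNIV\<close>.  Real matrices are complex matrices with real entries; in particular
  \<^const>\<open>eigenvalue\<close> always refers to complex eigenvalues.
\<close>

definition mat_over :: "complex set \<Rightarrow> nat \<Rightarrow> complex mat set" where
  "mat_over K n = {A \<in> carrier_mat n n. elements_mat A \<subseteq> K}"

definition inv_mat :: "complex mat \<Rightarrow> complex mat" where
  "inv_mat A = the (mat_inverse A)"

abbreviation conj_mat :: "complex mat \<Rightarrow> complex mat" where
  "conj_mat A \<equiv> map_mat cnj A"

datatype scalar_product_kind = Bilinear | Sesquilinear

fun star :: "scalar_product_kind \<Rightarrow> complex mat \<Rightarrow> complex mat" where
  "star Bilinear A = transpose_mat A"
| "star Sesquilinear A = transpose_mat (conj_mat A)"

text \<open>\<open>adj2 k M N A\<close> is $A^{[M,N]} = N^{-1} A^\# M$, and \<open>adj k N A\<close> is $A^{[N]}$.\<close>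

definition adj2 ::
    "scalar_product_kind \<Rightarrow> complex mat \<Rightarrow> complex mat \<Rightarrow> complex mat \<Rightarrow> complex mat" where
  "adj2 k M N A = inv_mat N * star k A * M"

abbreviation adj :: "scalar_product_kind \<Rightarrow> complex mat \<Rightarrow> complex mat \<Rightarrow> complex mat" where
  "adj k N A \<equiv> adj2 k N N A"

definition selfadjoint :: "scalar_product_kind \<Rightarrow> complex mat \<Rightarrow> complex mat \<Rightarrow> bool" where
  "selfadjoint k N A \<longleftrightarrow> adj k N A = A"

definition unitary2 ::
    "scalar_product_kind \<Rightarrow> complex mat \<Rightarrow> complex mat \<Rightarrow> complex mat \<Rightarrow> bool" where
  "unitary2 k M N W \<longleftrightarrow>
     adj2 k M N W * W = 1\<^sub>m (dim_row W) \<and> W * adj2 k M N W = 1\<^sub>m (dim_row W)"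

definition r_positive_definite :: "complex mat \<Rightarrow> bool" where
  "r_positive_definite A \<longleftrightarrow> (\<forall>l. eigenvalue A l \<longrightarrow> Re l > 0)"

text \<open>The principal square root, defined only for matrices without eigenvalues in $(-\infty,0]$.\<close>

definition principal_sqrt :: "complex mat \<rightharpoonup> complex mat" where
  "principal_sqrt A =
     (if \<forall>l. eigenvalue A l \<longrightarrow> \<not> (l \<in> \<real> \<and> Re l \<le> 0)
      then Some (THE X. X \<in> carrier_mat (dim_row A) (dim_row A) \<and> X * X = A \<and>
                        (\<forall>l. eigenvalue X l \<longrightarrow> Re l > 0))
      else None)"

text \<open>
  A stem function is a partial map \<open>f\<close>; if \<open>f l = Some d\<close> then \<open>d 0\<close> is the value at \<open>l\<close> and
  \<open>d j\<close> is the (arbitrarily assigned) \<open>j\<close>-th derivative value at \<open>l\<close>.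
\<close>

type_synonym stem = "complex \<rightharpoonup> (nat \<Rightarrow> complex)"

definition stem_jordan_block :: "stem \<Rightarrow> nat \<Rightarrow> complex \<Rightarrow> complex mat" where
  "stem_jordan_block f s l =
     mat s s (\<lambda>(i, j). if i \<le> j then the (f l) (j - i) / fact (j - i) else 0)"

definition stem_jordan_matrix :: "stem \<Rightarrow> (nat \<times> complex) list \<Rightarrow> complex mat" where
  "stem_jordan_matrix f n_as = diag_block_mat (map (\<lambda>(s, l). stem_jordan_block f s l) n_as)"

text \<open>
  The value does not depend on the Jordan decomposition that is selected.  The function is defined
  at \<open>A\<close> iff the stem function is defined at every eigenvalue of \<open>A\<close>.
\<close>

definition primary_matrix_function :: "stem \<Rightarrow> complex mat \<rightharpoonup> complex mat" where
  "primary_matrix_function f A =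
     (if \<forall>l. eigenvalue A l \<longrightarrow> l \<in> dom f
      then Some (SOME B. \<exists>n_as Q Q'. 0 \<notin> fst ` set n_as \<and>
                           similar_mat_wit A (jordan_matrix n_as) Q Q' \<and>
                           B = Q * stem_jordan_matrix f n_as * Q')
      else None)"

text \<open>
  Since the stem function is undefined at \<open>0\<close>, \<open>sgm A = None\<close> for singular \<open>A\<close>.
\<close>

definition generalized_matrix_sign ::
    "complex set \<Rightarrow> nat \<Rightarrow> (complex mat \<rightharpoonup> complex mat) \<Rightarrow> bool" where
  "generalized_matrix_sign K n sgm \<longleftrightarrow>
     (\<exists>f. f 0 = None \<and> (\<forall>A \<in> mat_over K n. sgm A = primary_matrix_function f A)) \<and>
     (\<forall>A \<in> mat_over K n. invertible_mat A \<longrightarrow>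
        (\<exists>B \<in> mat_over K n. sgm A = Some B \<and>
           (\<forall>l. eigenvalue (B * A) l \<longrightarrow> \<not> (l \<in> \<real> \<and> Re l < 0)) \<and>
           sgm (conj_mat A) = Some (conj_mat B) \<and>
           (\<forall>l. eigenvalue B l \<longrightarrow> cmod l = 1)))"

text \<open>
  \<open>F = W S\<close> is a decomposition as in the theorem, where \<open>Sig\<close> is $\Sigma = \sigma(F^{[N]}F)$; that
  \<open>Sig\<close> is defined is part of the condition.
\<close>

definition generalized_polar_decomposition ::
    "complex set \<Rightarrow> nat \<Rightarrow> scalar_product_kind \<Rightarrow> complex mat \<Rightarrow> (complex mat \<rightharpoonup> complex mat) \<Rightarrow>
     complex mat \<Rightarrow> complex mat \<Rightarrow> complex mat \<Rightarrow> bool" where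
  "generalized_polar_decomposition K n k N sgm F W S \<longleftrightarrow>
     W \<in> mat_over K n \<and> S \<in> mat_over K n \<and> F = W * S \<and>
     (\<exists>Sig. sgm (adj k N F * F) = Some Sig \<and>
        unitary2 k N (N * inv_mat Sig) W \<and> adj k N (adj k N W) = W \<and>
        r_positive_definite S \<and> selfadjoint k N S \<and> selfadjoint k (N * Sig) S)"

end

theory Submission
  imports Defs "HOL-Computational_Algebra.Formal_Power_Series"
begin

text \<open>
  Write \<open>A\<close> for $F^{[N]}F$.  A decomposition forces $\Sigma A = S^2$ because \<open>S\<close> is
  \<open>N\<close>-selfadjoint and commutes with \<open>\<Sigma>\<close>; principal square roots are unique, since
  $X^2 = Y^2$ makes \<open>Z = X - Y\<close> a solution of the Sylvester equation \<open>X Z = Z (- Y)\<close>, whose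
  coefficients have disjoint spectra.  Conversely, Hermite interpolation of the stem function on
  the spectra of \<open>A\<close> and of its conjugate turns \<open>\<Sigma>\<close> into a polynomial in \<open>A\<close>, so
  \<open>\<Sigma>\<close> is \<open>N\<close>-selfadjoint and commutes with \<open>A\<close>.  With \<open>S\<close> the principal square root
  of \<open>\<Sigma> A\<close>, each required symmetry of \<open>S\<close> (under the adjoint, under complex
  conjugation in the real case, under conjugation by \<open>\<Sigma>\<close>) holds because the transformed matrix
  is again a principal square root of \<open>\<Sigma> A\<close>.
\<close>

section \<open>Polynomials of a square matrix\<close>

text \<open>Horner's scheme. The size of the identity is read off from \<open>A\<close>, because the
  matrix type does not carry dimensions.\<close>

definition mat_poly :: "'a::field mat \<Rightarrow> 'a poly \<Rightarrow> 'a mat" where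
  "mat_poly A p = fold_coeffs (\<lambda>a M. a \<cdot>\<^sub>m 1\<^sub>m (dim_row A) + A * M) p (0\<^sub>m (dim_row A) (dim_row A))"

lemma mat_poly_0: "A \<in> carrier_mat n n \<Longrightarrow> mat_poly A 0 = 0\<^sub>m n n"
  by (simp add: mat_poly_def)

lemma mat_poly_pCons:
  assumes "A \<in> carrier_mat n n"
  shows "mat_poly A (pCons a p) = a \<cdot>\<^sub>m 1\<^sub>m n + A * mat_poly A p"
proof (cases "a = 0 \<and> p = 0")
  case True
  have "0 \<cdot>\<^sub>m 1\<^sub>m n + A * 0\<^sub>m n n = 0\<^sub>m n n"
    using assms by (intro eq_matI) auto
  then show ?thesis using True assms by (simp add: mat_poly_0)
next
  case False
  then show ?thesis using assms by (auto simp: mat_poly_def)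
qed

lemma mat_poly_carrier [simp]:
  "A \<in> carrier_mat n n \<Longrightarrow> mat_poly A p \<in> carrier_mat n n"
  by (induct p) (auto simp: mat_poly_0 mat_poly_pCons)

lemma mat_poly_add:
  assumes A: "A \<in> carrier_mat n n"
  shows "mat_poly A (p + q) = mat_poly A p + mat_poly A q"
  supply [simp] = carrier_matD[OF mat_poly_carrier[OF A]]
proof (induct p q rule: poly_induct2)
  case 0
  show ?case using A by (simp add: mat_poly_0)
next
  case (pCons a p b q)
  have "A * (mat_poly A p + mat_poly A q) = A * mat_poly A p + A * mat_poly A q"
    using A by (intro mult_add_distrib_mat[of _ n n _ n]) auto
  then show ?case using A
    by (simp add: mat_poly_pCons pCons, intro eq_matI) (auto simp: algebra_simps)
qed

lemma mat_poly_smult: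
  assumes A: "A \<in> carrier_mat n n"
  shows "mat_poly A (Polynomial.smult c p) = c \<cdot>\<^sub>m mat_poly A p"
  supply [simp] = carrier_matD[OF mat_poly_carrier[OF A]]
proof (induct p)
  case 0
  show ?case using A by (simp add: mat_poly_0)
next
  case (pCons a p)
  have "A * (c \<cdot>\<^sub>m mat_poly A p) = c \<cdot>\<^sub>m (A * mat_poly A p)"
    using A by (intro mult_smult_distrib[of _ n n _ n]) auto
  then show ?case using A
    by (simp add: mat_poly_pCons pCons, intro eq_matI) (auto simp: algebra_simps)
qed

lemma mat_poly_mult:
  assumes A: "A \<in> carrier_mat n n"
  shows "mat_poly A (p * q) = mat_poly A p * mat_poly A q"
  supply [simp] = carrier_matD[OF mat_poly_carrier[OF A]]
proof (induct p)
  case 0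
  show ?case using A by (simp add: mat_poly_0 left_mult_zero_mat[of _ n n])
next
  case (pCons a p)
  let ?P = "mat_poly A p" and ?Q = "mat_poly A q"
  have "mat_poly A (pCons a p * q) = a \<cdot>\<^sub>m ?Q + A * (?P * ?Q)"
  proof -
    have "0 \<cdot>\<^sub>m 1\<^sub>m n + A * (?P * ?Q) = A * (?P * ?Q)"
      using A by (intro eq_matI) auto
    then show ?thesis
      using A by (simp add: mat_poly_add mat_poly_smult mat_poly_pCons pCons)
  qed
  also have "\<dots> = (a \<cdot>\<^sub>m 1\<^sub>m n + A * ?P) * ?Q"
    using A by (simp add: add_mult_distrib_mat[of _ n n _ _ n]
        assoc_mult_mat[of _ n n _ n _ n] mult_smult_assoc_mat[of _ n n _ n]
        left_mult_one_mat[of _ n n])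
  finally show ?case using A by (simp add: mat_poly_pCons)
qed

text \<open>By induction \<open>P\<close> passes one factor of \<open>A\<close> at a time. With
  different \<open>P\<close> this yields commutation of \<open>A\<close> with its polynomials,
  passage to a Jordan form, the Sylvester argument, and, for \<open>P = N\<close>, self-adjointness
  of \<Sigma>.\<close>

lemma mat_poly_intertwine:
  assumes A: "A \<in> carrier_mat n n" and B: "B \<in> carrier_mat m m" and P: "P \<in> carrier_mat m n"
    and PA: "P * A = B * P"
  shows "P * mat_poly A p = mat_poly B p * P"
proof (induct p)
  case 0
  show ?case using A B P by (simp add: mat_poly_0)
next
  case (pCons a p)
  let ?X = "mat_poly A p" and ?Y = "mat_poly B p"
  have "P * (a \<cdot>\<^sub>m 1\<^sub>m n + A * ?X) = a \<cdot>\<^sub>m P + (P * A) * ?X"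
    using A P by (simp add: mult_add_distrib_mat[of _ m n _ n] mult_smult_distrib[of _ m n _ n]
        right_mult_one_mat[of _ m n] assoc_mult_mat[of _ m n _ n _ n])
  also have "\<dots> = a \<cdot>\<^sub>m P + B * (P * ?X)"
    using A B P by (simp add: PA assoc_mult_mat[of _ m m _ n _ n])
  also have "\<dots> = (a \<cdot>\<^sub>m 1\<^sub>m m + B * ?Y) * P"
    using B P by (simp add: pCons add_mult_distrib_mat[of _ m m _ _ n]
        mult_smult_assoc_mat[of _ m m _ n] left_mult_one_mat[of _ m n]
        assoc_mult_mat[of _ m m _ m _ n])
  finally show ?case using A B by (simp add: mat_poly_pCons)
qed

lemma mat_poly_transpose:
  assumes A: "A \<in> carrier_mat n n"
  shows "mat_poly (transpose_mat A) p = transpose_mat (mat_poly A p)"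
proof (induct p)
  case 0
  show ?case using A by (simp add: mat_poly_0)
next
  case (pCons a p)
  have [simp]: "transpose_mat A \<in> carrier_mat n n" using A by simp
  have "transpose_mat A * transpose_mat (mat_poly A p) = transpose_mat (mat_poly A p * A)"
    using A by (simp add: transpose_mult[of _ n n _ n])
  \<comment> \<open>Transposition reverses the product and leaves \<open>A\<close> on the wrong
    side; it commutes with its own polynomials.\<close>
  also have "mat_poly A p * A = A * mat_poly A p"
    using mat_poly_intertwine[OF A A A refl] by simp
  finally have *: "transpose_mat A * transpose_mat (mat_poly A p) = transpose_mat (A * mat_poly A p)" .
  have "transpose_mat (a \<cdot>\<^sub>m 1\<^sub>m n + A * mat_poly A p)
      = transpose_mat (a \<cdot>\<^sub>m 1\<^sub>m n) + transpose_mat (A * mat_poly A p)"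
    using A by (intro transpose_add[of _ n n]) auto
  moreover have "transpose_mat (a \<cdot>\<^sub>m 1\<^sub>m n :: 'a mat) = a \<cdot>\<^sub>m 1\<^sub>m n"
    by (intro eq_matI) auto
  ultimately show ?case using A by (simp add: mat_poly_pCons[of _ n] pCons *)
qed

lemma mat_poly_mult_eigenvector:
  assumes A: "A \<in> carrier_mat n n" and v: "v \<in> carrier_vec n" and Av: "A *\<^sub>v v = l \<cdot>\<^sub>v v"
  shows "mat_poly A p *\<^sub>v v = poly p l \<cdot>\<^sub>v v"
proof (induct p)
  case 0
  show ?case using A v by (simp add: mat_poly_0, intro eq_vecI) auto
next
  case (pCons a p)
  have "(a \<cdot>\<^sub>m 1\<^sub>m n + A * mat_poly A p) *\<^sub>v v = (a \<cdot>\<^sub>m 1\<^sub>m n) *\<^sub>v v + (A * mat_poly A p) *\<^sub>v v"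
    using A v by (intro add_mult_distrib_mat_vec[of _ n n]) auto
  also have "(A * mat_poly A p) *\<^sub>v v = A *\<^sub>v (poly p l \<cdot>\<^sub>v v)"
    using A v by (simp add: assoc_mult_mat_vec[of _ n n _ n] pCons)
  also have "\<dots> = poly p l \<cdot>\<^sub>v (l \<cdot>\<^sub>v v)"
    using A v by (simp add: mult_mat_vec[of _ n n] Av)
  also have "(a \<cdot>\<^sub>m 1\<^sub>m n) *\<^sub>v v = a \<cdot>\<^sub>v v"
    using v by (intro eq_vecI) auto
  finally show ?case
    using A v by (simp add: mat_poly_pCons, intro eq_vecI) (auto simp: algebra_simps)
qed

section \<open>Polynomials of Jordan blocks and Jordan matrices\<close>

lemma mat_poly_four_block:
  assumes A: "A \<in> carrier_mat n n" and D: "D \<in> carrier_mat m m"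
  shows "mat_poly (four_block_mat A (0\<^sub>m n m) (0\<^sub>m m n) D) p =
    four_block_mat (mat_poly A p) (0\<^sub>m n m) (0\<^sub>m m n) (mat_poly D p)"
proof (induct p)
  case 0
  show ?case using A D by (simp add: mat_poly_0[of _ n] mat_poly_0[of _ m] mat_poly_0[of _ "n + m"])
next
  case (pCons a p)
  let ?M = "four_block_mat A (0\<^sub>m n m) (0\<^sub>m m n) D"
  let ?P = "mat_poly A p" and ?Q = "mat_poly D p"
  have M: "?M \<in> carrier_mat (n + m) (n + m)" using A D by auto
  have "?M * four_block_mat ?P (0\<^sub>m n m) (0\<^sub>m m n) ?Q =
      four_block_mat (A * ?P) (0\<^sub>m n m) (0\<^sub>m m n) (D * ?Q)"
    using A D by (subst mult_four_block_mat[of _ n n _ m _ m _ _ n _ m])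
      (auto simp: left_mult_zero_mat[of _ n n] left_mult_zero_mat[of _ m m])
  moreover have "a \<cdot>\<^sub>m 1\<^sub>m (n + m) = four_block_mat (a \<cdot>\<^sub>m 1\<^sub>m n) (0\<^sub>m n m) (0\<^sub>m m n) (a \<cdot>\<^sub>m 1\<^sub>m m)"
    by (intro eq_matI) auto
  ultimately show ?case
    using A D M by (simp add: mat_poly_pCons[of _ n] mat_poly_pCons[of _ m]
        mat_poly_pCons[of _ "n + m"] pCons, subst add_four_block_mat[of _ n n _ m _ m]) auto
qed

lemma coeff_0_pcompose_shift: "coeff (p \<circ>\<^sub>p [:l, 1:]) 0 = poly p l"
  by (simp add: poly_pcompose flip: poly_0_coeff_0)

text \<open>The block is \<open>l\<close> plus a nilpotent shift, so it acts on upper triangular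
  Toeplitz matrices like multiplication by \<open>l + x\<close>. The coefficients of
  \<open>p \<circ>\<^sub>p [:l, 1:]\<close> are the Taylor coefficients of \<open>p\<close> at
  \<open>l\<close>, obtained without dividing by factorials.\<close>

lemma mat_poly_jordan_block:
  fixes l :: "'a::field"
  shows "mat_poly (jordan_block s l) p =
    mat s s (\<lambda>(i, j). if i \<le> j then coeff (p \<circ>\<^sub>p [:l, 1:]) (j - i) else 0)"
proof (induct p)
  case 0
  show ?case by (intro eq_matI) (auto simp: mat_poly_0[of _ s])
next
  case (pCons a p)
  let ?T = "mat s s (\<lambda>(i, j). if i \<le> j then coeff (p \<circ>\<^sub>p [:l, 1:]) (j - i) else 0)"
  \<comment> \<open>Row \<open>i\<close> of the block holds \<open>l\<close> on the diagonal and a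
    one to its right, which is absent in the last row.\<close>
  have row: "(jordan_block s l * ?T) $$ (i, j) =
      l * ?T $$ (i, j) + (if Suc i < s then ?T $$ (Suc i, j) else 0)"
    if "i < s" "j < s" for i j
  proof -
    have "(jordan_block s l * ?T) $$ (i, j) = (\<Sum>x = 0..<s. jordan_block s l $$ (i, x) * ?T $$ (x, j))"
      using that by (simp add: scalar_prod_def del: jordan_block_index(1))
    also have "\<dots> = (\<Sum>x = 0..<s. (if x = i then l * ?T $$ (i, j) else 0) +
                     (if x = Suc i then ?T $$ (Suc i, j) else 0))"
      using that by (intro sum.cong) auto
    finally show ?thesis using that by (simp add: sum.distrib)
  qed
  show ?case
    unfolding mat_poly_pCons[OF jordan_block_carrier] pCons
  proof (rule eq_matI, goal_cases)
    case (1 i j)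
    then have ij: "i < s" "j < s" by auto
    then have "(a \<cdot>\<^sub>m 1\<^sub>m s + jordan_block s l * ?T) $$ (i, j) =
       (if i = j then a else 0) + (jordan_block s l * ?T) $$ (i, j)" by simp
    also have "\<dots> = (if i = j then a else 0) +
        (l * ?T $$ (i, j) + (if Suc i < s then ?T $$ (Suc i, j) else 0))"
      by (simp only: row[OF ij])
    finally show ?case
      by (rule trans) (use ij in \<open>auto simp: pcompose_pCons coeff_pCons coeff_0_pcompose_shift diff_Suc split: nat.split\<close>)
  qed auto
qed

text \<open>A block of size \<open>s\<close> sees only the Taylor coefficients of order below
  \<open>s\<close> at its eigenvalue, so matching these is enough.\<close>

lemma mat_poly_jordan_matrix:
  assumes "\<And>s l k. (s, l) \<in> set n_as \<Longrightarrow> k < s \<Longrightarrow>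
    coeff (p \<circ>\<^sub>p [:l, 1:]) k = the (f l) k / fact k"
  shows "mat_poly (jordan_matrix n_as) p = stem_jordan_matrix f n_as"
  using assms
proof (induct n_as)
  case Nil
  note [simp] = carrier_matD[OF mat_poly_carrier[of "0\<^sub>m 0 0" 0]]
  show ?case by (auto simp: stem_jordan_matrix_def jordan_matrix_def intro!: eq_matI)
next
  case (Cons sl n_as)
  obtain s l where sl: "sl = (s, l)" by force
  let ?m = "sum_list (map fst n_as)"
  have IH: "mat_poly (jordan_matrix n_as) p = stem_jordan_matrix f n_as"
    using Cons by auto
  have m: "stem_jordan_matrix f n_as \<in> carrier_mat ?m ?m"
    unfolding IH[symmetric] by simp
  have "mat_poly (jordan_block s l) p = stem_jordan_block f s l"
    unfolding mat_poly_jordan_block stem_jordan_block_def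
    using Cons(2)[of s l] sl by (intro cong_mat) auto
  moreover have "dim_row (stem_jordan_block f s l) = s" "dim_col (stem_jordan_block f s l) = s"
    by (simp_all add: stem_jordan_block_def)
  ultimately show ?case
    using m unfolding sl jordan_matrix_Cons
    by (subst mat_poly_four_block) (auto simp: IH stem_jordan_matrix_def Let_def)
qed

section \<open>Hermite interpolation\<close>

text \<open>The substitution turns the factor into \<open>x ^ m\<close>, which shifts the
  coefficients by \<open>m\<close> places.\<close>

lemma coeff_pcompose_shift_power_mult:
  fixes g :: "'a::comm_ring_1 poly"
  shows "coeff (([:- l, 1:] ^ m * g) \<circ>\<^sub>p [:l, 1:]) k =
    (if k < m then 0 else coeff (g \<circ>\<^sub>p [:l, 1:]) (k - m))"
proof -
  have "([:- l, 1:] ^ m) \<circ>\<^sub>p [:l, 1:] = monom 1 m"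
  proof (induct m)
    case (Suc m)
    have "[:- l, 1:] \<circ>\<^sub>p [:l, 1:] = [:0, 1:]" by (simp add: pcompose_pCons)
    then show ?case by (simp only: power_Suc pcompose_mult Suc) (simp add: monom_Suc)
  qed (simp add: pcompose_1)
  then show ?thesis by (simp add: pcompose_mult coeff_monom_mult)
qed

text \<open>Nodes are added one at a time, and at a new node the coefficients are corrected in
  increasing order. Phrased with Taylor coefficients instead of derivatives, this works over any
  field.\<close>

lemma hermite_interpolation:
  fixes c :: "'a::field \<Rightarrow> nat \<Rightarrow> 'a"
  assumes "finite E"
  shows "\<exists>p. \<forall>l\<in>E. \<forall>k<m. coeff (p \<circ>\<^sub>p [:l, 1:]) k = c l k"
  using assms
proof (induct E)
  case empty
  show ?case by simp
next
  case (insert l E)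
  then obtain p where p: "\<forall>u\<in>E. \<forall>k<m. coeff (p \<circ>\<^sub>p [:u, 1:]) k = c u k" by auto
  \<comment> \<open>\<open>h\<close> vanishes to order \<open>m\<close> at every old node but not at
    \<open>l\<close>, so adding multiples of it keeps the old conditions.\<close>
  define h where "h = (\<Prod>u\<in>E. [:- u, 1:] ^ m)"
  have h_l: "poly h l \<noteq> 0"
    using insert by (auto simp: h_def poly_prod)
  have h_u: "coeff ((h * g) \<circ>\<^sub>p [:u, 1:]) k = 0" if "u \<in> E" "k < m" for u g k
  proof -
    have "h = [:- u, 1:] ^ m * (\<Prod>u\<in>E - {u}. [:- u, 1:] ^ m)"
      unfolding h_def using that insert by (subst prod.remove[of _ u]) auto
    then show ?thesis using that by (simp only: mult.assoc coeff_pcompose_shift_power_mult) simp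
  qed
  have "\<exists>q. (\<forall>u\<in>E. \<forall>k<m. coeff (q \<circ>\<^sub>p [:u, 1:]) k = c u k) \<and>
      (\<forall>k<j. coeff (q \<circ>\<^sub>p [:l, 1:]) k = c l k)" for j
  proof (induct j)
    case 0
    show ?case using p by auto
  next
    case (Suc j)
    then obtain q where q: "\<forall>u\<in>E. \<forall>k<m. coeff (q \<circ>\<^sub>p [:u, 1:]) k = c u k"
      "\<forall>k<j. coeff (q \<circ>\<^sub>p [:l, 1:]) k = c l k" by auto
    \<comment> \<open>At \<open>l\<close> the correction \<open>h * [:- l, 1:] ^ j\<close> starts at
      order \<open>j\<close> with coefficient \<open>poly h l\<close>; lower orders stay as they are
      and \<open>a\<close> repairs order \<open>j\<close>.\<close>
    define a where "a = (c l j - coeff (q \<circ>\<^sub>p [:l, 1:]) j) / poly h l"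
    define r where "r = q + Polynomial.smult a (h * [:- l, 1:] ^ j)"
    have "coeff (r \<circ>\<^sub>p [:u, 1:]) k = c u k" if "u \<in> E" "k < m" for u k
      using that q h_u[OF that] by (simp add: r_def pcompose_add pcompose_smult)
    moreover have "coeff (r \<circ>\<^sub>p [:l, 1:]) k = c l k" if "k < Suc j" for k
    proof -
      have "coeff (r \<circ>\<^sub>p [:l, 1:]) k =
          coeff (q \<circ>\<^sub>p [:l, 1:]) k + a * coeff (([:- l, 1:] ^ j * h) \<circ>\<^sub>p [:l, 1:]) k"
        by (simp add: r_def pcompose_add pcompose_smult mult.commute)
      then show ?thesis
        unfolding coeff_pcompose_shift_power_mult
        using that q h_l by (cases "k = j") (auto simp: a_def coeff_0_pcompose_shift)
    qed
    ultimately show ?case by blast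
  qed
  from this[of m] show ?case by auto
qed

section \<open>Primary matrix functions\<close>

lemma jordan_decomposition_exists:
  fixes A :: "complex mat"
  assumes "A \<in> carrier_mat n n"
  obtains n_as Q Q' where "0 \<notin> fst ` set n_as" "similar_mat_wit A (jordan_matrix n_as) Q Q'"
proof -
  from char_poly_factorized[OF assms] obtain as where "char_poly A = (\<Prod>a\<leftarrow>as. [:- a, 1:])"
    by auto
  from jordan_nf_exists[OF assms this] show ?thesis
    using that by (auto simp: jordan_nf_def similar_mat_def)
qed

text \<open>These two facts ensure that interpolation to order \<open>n\<close> at the eigenvalues
  of \<open>A\<close> covers every Jordan block.\<close>

lemma eigenvalue_jordan_decomposition:
  fixes A :: "complex mat"
  assumes "A \<in> carrier_mat n n" and "0 \<notin> fst ` set n_as"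
    and "similar_mat_wit A (jordan_matrix n_as) Q Q'" and "(s, l) \<in> set n_as"
  shows "eigenvalue A l" "s \<le> n"
proof -
  have "char_poly A = (\<Prod>(s, l)\<leftarrow>n_as. [:- l, 1:] ^ s)"
    using char_poly_similar[of A "jordan_matrix n_as"] assms(3)
    by (auto simp: similar_mat_def jordan_matrix_char_poly)
  \<comment> \<open>An empty block could carry a number that is not an eigenvalue.\<close>
  moreover have "s \<noteq> 0" using assms by force
  ultimately have "poly (char_poly A) l = 0"
    using assms(4) by (force simp: poly_prod_list prod_list_zero_iff)
  then show "eigenvalue A l" by (simp add: eigenvalue_root_char_poly[OF assms(1)])
  have "n = sum_list (map fst n_as)"
    using similar_mat_witD2(5)[OF assms(1,3)] by (metis carrier_matD(1) jordan_matrix_dim(1))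
  then show "s \<le> n" using assms(4) member_le_sum_list[of s "map fst n_as"] by force
qed

text \<open>The definition selects a Jordan decomposition by \<open>SOME\<close>. Since
  \<open>A * Q = Q * J\<close> carries over to polynomials, every decomposition yields
  \<open>mat_poly A p\<close>, and the choice is harmless.\<close>

lemma primary_matrix_function_eq_mat_poly:
  assumes A: "A \<in> carrier_mat n n"
    and dom: "\<And>l. eigenvalue A l \<Longrightarrow> l \<in> dom f"
    and p: "\<And>l k. eigenvalue A l \<Longrightarrow> k < n \<Longrightarrow>
      coeff (p \<circ>\<^sub>p [:l, 1:]) k = the (f l) k / fact k"
  shows "primary_matrix_function f A = Some (mat_poly A p)"
proof -
  let ?dec = "\<lambda>B. \<exists>n_as Q Q'. 0 \<notin> fst ` set n_as \<and>
    similar_mat_wit A (jordan_matrix n_as) Q Q' \<and> B = Q * stem_jordan_matrix f n_as * Q'"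
  have unique: "B = mat_poly A p" if dec: "?dec B" for B
  proof -
    from dec obtain n_as Q Q' where D: "0 \<notin> fst ` set n_as"
      "similar_mat_wit A (jordan_matrix n_as) Q Q'" and B: "B = Q * stem_jordan_matrix f n_as * Q'"
      by blast
    let ?J = "jordan_matrix n_as"
    note W = similar_mat_witD2[OF A D(2)]
    note eig = eigenvalue_jordan_decomposition[OF A D]
    have J: "mat_poly ?J p = stem_jordan_matrix f n_as"
      by (rule mat_poly_jordan_matrix) (use p eig in fastforce)
    have "A * Q = Q * ?J * (Q' * Q)"
      unfolding W(3) using W(5-7) by (simp add: assoc_mult_mat[of _ n n _ n _ n])
    then have "Q * ?J = A * Q"
      using W(2,5,6) by (simp add: right_mult_one_mat[of _ n n] mult_carrier_mat[of _ n n _ n])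
    from mat_poly_intertwine[OF W(5) A W(6) this]
    have "Q * mat_poly ?J p * Q' = mat_poly A p * (Q * Q')"
      using W(6,7) A by (simp add: assoc_mult_mat[of _ n n _ n _ n])
    then show ?thesis using W(1) A by (simp add: B J right_mult_one_mat[of _ n n])
  qed
  obtain n_as Q Q' where "0 \<notin> fst ` set n_as" "similar_mat_wit A (jordan_matrix n_as) Q Q'"
    by (rule jordan_decomposition_exists[OF A])
  then have "?dec (Q * stem_jordan_matrix f n_as * Q')"
    by (intro exI conjI) (assumption | rule refl)+
  then have "?dec (Eps ?dec)" by (rule someI)
  then have "Eps ?dec = mat_poly A p" by (rule unique)
  then show ?thesis unfolding primary_matrix_function_def using dom by auto
qed

text \<open>The Taylor data of \<open>p\<close> form a stem function, with \<open>fact k\<close>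
  undoing the normalisation; both polynomials represent its primary function.\<close>

lemma mat_poly_cong:
  fixes A :: "complex mat"
  assumes "A \<in> carrier_mat n n"
    and "\<And>l k. eigenvalue A l \<Longrightarrow> k < n \<Longrightarrow>
      coeff (p \<circ>\<^sub>p [:l, 1:]) k = coeff (q \<circ>\<^sub>p [:l, 1:]) k"
  shows "mat_poly A p = mat_poly A q"
proof -
  let ?f = "\<lambda>l. Some (\<lambda>k. fact k * coeff (p \<circ>\<^sub>p [:l, 1:]) k)"
  have "primary_matrix_function ?f A = Some (mat_poly A p)"
    by (rule primary_matrix_function_eq_mat_poly) (use assms in auto)
  moreover have "primary_matrix_function ?f A = Some (mat_poly A q)"
    by (rule primary_matrix_function_eq_mat_poly) (use assms in auto)
  ultimately show ?thesis by simp
qed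

lemma finite_eigenvalues:
  fixes A :: "complex mat"
  assumes "A \<in> carrier_mat n n"
  shows "finite {l. eigenvalue A l}"
  using assms degree_monic_char_poly[OF assms]
  by (auto simp: eigenvalue_root_char_poly intro!: poly_roots_finite)

text \<open>\<open>p\<close> is fixed before \<open>A\<close>, so that one polynomial can serve a
  matrix and its conjugate simultaneously.\<close>

lemma primary_matrix_function_interpolation:
  assumes "finite E" and "E \<subseteq> dom f"
  obtains p where "\<And>A. A \<in> carrier_mat n n \<Longrightarrow> (\<And>l. eigenvalue A l \<Longrightarrow> l \<in> E) \<Longrightarrow>
    primary_matrix_function f A = Some (mat_poly A p)"
proof -
  from hermite_interpolation[OF assms(1), of n "\<lambda>l k. the (f l) k / fact k"] obtain p where
    "\<forall>l\<in>E. \<forall>k<n. coeff (p \<circ>\<^sub>p [:l, 1:]) k = the (f l) k / fact k" by blast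
  then have "primary_matrix_function f A = Some (mat_poly A p)"
    if "A \<in> carrier_mat n n" "\<And>l. eigenvalue A l \<Longrightarrow> l \<in> E" for A
    using that assms(2) by (intro primary_matrix_function_eq_mat_poly) blast+
  then show ?thesis using that by blast
qed

section \<open>Principal square roots\<close>

lemma mat_poly_const:
  "A \<in> carrier_mat n n \<Longrightarrow> mat_poly A [:c:] = c \<cdot>\<^sub>m 1\<^sub>m n"
  by (simp add: mat_poly_pCons mat_poly_0)

lemma mat_poly_X:
  assumes "A \<in> carrier_mat n n"
  shows "mat_poly A [:0, 1:] = A"
proof -
  have "0 \<cdot>\<^sub>m 1\<^sub>m n + A * 1\<^sub>m n = A" using assms by (intro eq_matI) auto
  moreover have "1 \<cdot>\<^sub>m 1\<^sub>m n = (1\<^sub>m n :: 'a mat)" by (intro eq_matI) auto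
  ultimately show ?thesis using assms by (simp add: mat_poly_pCons mat_poly_0)
qed

text \<open>Interpolate by a polynomial that vanishes at \<open>X\<close> and is the identity at \<open>Y\<close>.\<close>

lemma sylvester_zero:
  fixes X Y Z :: "complex mat"
  assumes X: "X \<in> carrier_mat n n" and Y: "Y \<in> carrier_mat n n" and Z: "Z \<in> carrier_mat n n"
    and comm: "X * Z = Z * Y"
    and disj: "\<And>l. eigenvalue X l \<Longrightarrow> eigenvalue Y l \<Longrightarrow> False"
  shows "Z = 0\<^sub>m n n"
proof -
  let ?E = "{l. eigenvalue X l} \<union> {l. eigenvalue Y l}"
  have "finite ?E" using finite_eigenvalues X Y by auto
  from hermite_interpolation[OF this, of n "\<lambda>l k. if k = 0 \<and> eigenvalue Y l then 1 else 0"]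
  obtain p where p: "\<And>l k. l \<in> ?E \<Longrightarrow> k < n \<Longrightarrow>
      coeff (p \<circ>\<^sub>p [:l, 1:]) k = (if k = 0 \<and> eigenvalue Y l then 1 else 0)" by blast
  have "mat_poly X p = mat_poly X 0"
    by (rule mat_poly_cong[OF X]) (use p disj in auto)
  moreover have "mat_poly Y p = mat_poly Y [:1:]"
    by (rule mat_poly_cong[OF Y]) (use p in \<open>auto simp: pcompose_pCons coeff_pCons split: nat.split\<close>)
  moreover have "1 \<cdot>\<^sub>m 1\<^sub>m n = (1\<^sub>m n :: complex mat)" by (intro eq_matI) auto
  moreover have "Z * mat_poly Y p = mat_poly X p * Z"
    by (rule mat_poly_intertwine[OF Y X Z]) (simp add: comm)
  ultimately show ?thesis
    using X Y Z by (simp add: mat_poly_0 mat_poly_const right_mult_one_mat[of _ n n]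
        left_mult_zero_mat[of _ n n])
qed

lemma eigenvalue_iff:
  assumes "A \<in> carrier_mat n n"
  shows "eigenvalue A l \<longleftrightarrow> (\<exists>v\<in>carrier_vec n. v \<noteq> 0\<^sub>v n \<and> A *\<^sub>v v = l \<cdot>\<^sub>v v)"
  using assms by (auto simp: eigenvalue_def eigenvector_def)

lemma eigenvalue_uminus_mat:
  fixes A :: "complex mat"
  assumes "A \<in> carrier_mat n n" and "eigenvalue (- A) l"
  shows "eigenvalue A (- l)"
proof -
  obtain v where v: "v \<in> carrier_vec n" "v \<noteq> 0\<^sub>v n" "(- A) *\<^sub>v v = l \<cdot>\<^sub>v v"
    using assms by (auto simp: eigenvalue_iff[of "- A" n])
  have "A *\<^sub>v v = - l \<cdot>\<^sub>v v"
  proof (rule eq_vecI)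
    fix i assume "i < dim_vec (- l \<cdot>\<^sub>v v)"
    then have "i < n" using v by simp
    then have "- (row A i \<bullet> v) = l * v $ i"
      using arg_cong[OF v(3), of "\<lambda>w. w $ i"] v(1) assms(1) by simp
    then show "(A *\<^sub>v v) $ i = (- l \<cdot>\<^sub>v v) $ i"
      using \<open>i < n\<close> assms(1) v(1) by (simp add: minus_equation_iff)
  qed (use assms v in simp)
  then show ?thesis using v assms by (auto simp: eigenvalue_iff[of _ n])
qed

lemma square_root_unique:
  fixes X Y :: "complex mat"
  assumes X: "X \<in> carrier_mat n n" "r_positive_definite X"
    and Y: "Y \<in> carrier_mat n n" "r_positive_definite Y"
    and eq: "X * X = Y * Y"
  shows "X = Y"
proof -
  have "X * (X - Y) = X * X - X * Y" "(X - Y) * (- Y) = - ((X - Y) * Y)"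
    "(X - Y) * Y = X * Y - Y * Y"
    using X(1) Y(1) by (auto simp: mult_minus_distrib_mat[of _ n n _ n]
        minus_mult_distrib_mat[of _ n n _ _ n])
  moreover have "X * X - X * Y = - (X * Y - Y * Y)"
    unfolding eq using X(1) Y(1) by (intro eq_matI) auto
  ultimately have comm: "X * (X - Y) = (X - Y) * (- Y)" by simp
  \<comment> \<open>Eigenvalues of \<open>X\<close> have positive real part, those of
    \<open>- Y\<close> negative real part.\<close>
  have "X - Y = 0\<^sub>m n n"
  proof (rule sylvester_zero[OF X(1) _ _ comm])
    fix l assume "eigenvalue X l" "eigenvalue (- Y) l"
    then have "Re l > 0" "Re (- l) > 0"
      using X(2) Y(2) eigenvalue_uminus_mat[OF Y(1)] unfolding r_positive_definite_def by blast+
    then show False by simp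
  qed (use X Y in auto)
  show ?thesis
  proof (rule eq_matI)
    fix i j assume "i < dim_row Y" "j < dim_col Y"
    then show "X $$ (i, j) = Y $$ (i, j)"
      using X(1) Y(1) arg_cong[OF \<open>X - Y = 0\<^sub>m n n\<close>, of "\<lambda>M. M $$ (i, j)"] by simp
  qed (use X Y in auto)
qed

text \<open>At each eigenvalue \<open>l\<close> the power series of the square root of
  \<open>l + x\<close> is interpolated to order \<open>n\<close>. The square of the resulting
  polynomial agrees with the identity function to that order, hence takes the value \<open>A\<close>
  at \<open>A\<close>.\<close>

lemma square_root_exists:
  fixes A :: "complex mat"
  assumes A: "A \<in> carrier_mat n n"
    and eig: "\<And>l. eigenvalue A l \<Longrightarrow> \<not> (l \<in> \<real> \<and> Re l \<le> 0)"
  obtains S where "S \<in> carrier_mat n n" "S * S = A" "r_positive_definite S"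
proof -
  define r where "r l = fps_radical (\<lambda>_ z. csqrt z) 2 (fps_const l + fps_X)" for l :: complex
  have r0: "fps_nth (r l) 0 = csqrt l" and r2: "r l ^ 2 = fps_const l + fps_X" if "eigenvalue A l" for l
  proof -
    \<comment> \<open>A formal square root needs a nonzero constant term.\<close>
    have "l \<noteq> 0" using eig[OF that] by auto
    then show "r l ^ 2 = fps_const l + fps_X"
      using power_radical[of "fps_const l + fps_X" "\<lambda>_ z. csqrt z" 1]
      by (simp add: r_def power2_csqrt[unfolded power2_eq_square] power2_eq_square numeral_2_eq_2)
    show "fps_nth (r l) 0 = csqrt l" using \<open>l \<noteq> 0\<close> by (simp add: r_def fps_radical_def numeral_2_eq_2)
  qed
  from hermite_interpolation[OF finite_eigenvalues[OF A], of n "\<lambda>l k. fps_nth (r l) k"]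
  obtain p where p: "\<And>l k. eigenvalue A l \<Longrightarrow> k < n \<Longrightarrow> coeff (p \<circ>\<^sub>p [:l, 1:]) k = fps_nth (r l) k" by blast
  let ?S = "mat_poly A p"
  have "mat_poly A (p * p) = mat_poly A [:0, 1:]"
  proof (rule mat_poly_cong[OF A])
    fix l k assume l: "eigenvalue A l" and k: "k < n"
    have "coeff ((p * p) \<circ>\<^sub>p [:l, 1:]) k = fps_nth (r l * r l) k"
      using k by (simp add: pcompose_mult coeff_mult fps_mult_nth p[OF l] atLeast0AtMost)
    also have "\<dots> = coeff ([:0, 1:] \<circ>\<^sub>p [:l, 1:]) k"
      using r2[OF l] by (auto simp: power2_eq_square pcompose_pCons coeff_pCons split: nat.split)
    finally show "coeff ((p * p) \<circ>\<^sub>p [:l, 1:]) k = coeff ([:0, 1:] \<circ>\<^sub>p [:l, 1:]) k" .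
  qed
  then have sq: "?S * ?S = A" using A by (simp add: mat_poly_mult mat_poly_X)
  \<comment> \<open>An eigenvector of \<open>?S\<close> for \<open>m\<close> is one of
    \<open>A\<close> for the square of \<open>m\<close>. Evaluating \<open>p\<close> there shows
    that \<open>m\<close> is the value of \<open>csqrt\<close>, so its real part is nonnegative; a
    zero real part would put an eigenvalue of \<open>A\<close> in the excluded half-line.\<close>
  have "Re m > 0" if m: "eigenvalue ?S m" for m
  proof -
    from m obtain v where v: "v \<in> carrier_vec n" "v \<noteq> 0\<^sub>v n" "?S *\<^sub>v v = m \<cdot>\<^sub>v v"
      using A by (auto simp: eigenvalue_iff[of _ n])
    have "?S *\<^sub>v (?S *\<^sub>v v) = m\<^sup>2 \<cdot>\<^sub>v v"
      using A v by (simp add: mult_mat_vec[of _ n n] smult_smult_assoc power2_eq_square)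
    then have Av: "A *\<^sub>v v = m\<^sup>2 \<cdot>\<^sub>v v"
      using A v assoc_mult_mat_vec[of ?S n n ?S n v] by (simp add: sq)
    then have l: "eigenvalue A (m\<^sup>2)" using A v by (auto simp: eigenvalue_iff[of _ n])
    \<comment> \<open>The interpolation conditions include order 0 only if \<open>n\<close> is
      positive.\<close>
    have "n > 0" using eigenvalue_imp_nonzero_dim[OF A l] .
    from mat_poly_mult_eigenvector[OF A v(1) Av, of p] v(3)
    have mp: "m \<cdot>\<^sub>v v = poly p (m\<^sup>2) \<cdot>\<^sub>v v" by simp
    from v obtain i where "i < n" "v $ i \<noteq> 0" by (metis eq_vecI carrier_vecD index_zero_vec)
    then have "m = poly p (m\<^sup>2)"
      using v(1) arg_cong[OF mp, of "\<lambda>w. w $ i"] by simp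
    also have "\<dots> = csqrt (m\<^sup>2)"
      using p[OF l \<open>n > 0\<close>] r0[OF l] by (simp add: coeff_0_pcompose_shift)
    finally have m_eq: "m = csqrt (m\<^sup>2)" .
    have "Re m \<ge> 0" using csqrt_principal[of "m\<^sup>2"] by (auto simp flip: m_eq)
    moreover have False if "Re m = 0"
    proof -
      have "m\<^sup>2 = - complex_of_real ((Im m)\<^sup>2)"
        using that by (auto simp: complex_eq_iff power2_eq_square)
      then show False using eig[OF l] by auto
    qed
    ultimately show ?thesis by fastforce
  qed
  then show ?thesis using that[of ?S] A sq by (simp add: r_positive_definite_def)
qed

text \<open>Factor the square of \<open>S\<close> minus that of \<open>m\<close> as
  \<open>S + m\<close> times \<open>S - m\<close>: either \<open>S - m\<close> kills
  \<open>v\<close>, or it maps \<open>v\<close> to an eigenvector for \<open>- m\<close>.\<close>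

lemma eigenvalue_square:
  fixes S :: "complex mat"
  assumes S: "S \<in> carrier_mat n n" and "eigenvalue (S * S) (m\<^sup>2)"
  shows "eigenvalue S m \<or> eigenvalue S (- m)"
proof -
  obtain v where v: "v \<in> carrier_vec n" "v \<noteq> 0\<^sub>v n" "(S * S) *\<^sub>v v = m\<^sup>2 \<cdot>\<^sub>v v"
    using assms by (auto simp: eigenvalue_iff[of "S * S" n])
  define w where "w = S *\<^sub>v v + (- m) \<cdot>\<^sub>v v"
  have w: "w \<in> carrier_vec n" using S v by (simp add: w_def)
  show ?thesis
  proof (cases "w = 0\<^sub>v n")
    case True
    have "S *\<^sub>v v = m \<cdot>\<^sub>v v"
    proof (rule eq_vecI)
      fix i assume "i < dim_vec (m \<cdot>\<^sub>v v)"
      then have "i < n" using v by simp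
      moreover from this have "w $ i = 0" using True by simp
      ultimately show "(S *\<^sub>v v) $ i = (m \<cdot>\<^sub>v v) $ i" using S v by (simp add: w_def)
    qed (use S v in simp)
    then show ?thesis using S v by (auto simp: eigenvalue_iff[of _ n])
  next
    case False
    have "S *\<^sub>v w = S *\<^sub>v (S *\<^sub>v v) + (- m) \<cdot>\<^sub>v (S *\<^sub>v v)"
      using S v by (simp add: w_def mult_add_distrib_mat_vec[of _ n n] mult_mat_vec[of _ n n])
    also have "S *\<^sub>v (S *\<^sub>v v) = m\<^sup>2 \<cdot>\<^sub>v v"
      using S v by (simp add: assoc_mult_mat_vec[of _ n n _ n])
    also have "m\<^sup>2 \<cdot>\<^sub>v v + (- m) \<cdot>\<^sub>v (S *\<^sub>v v) = (- m) \<cdot>\<^sub>v w"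
      using S v by (intro eq_vecI) (auto simp: w_def algebra_simps power2_eq_square)
    finally show ?thesis using S w False by (auto simp: eigenvalue_iff[of _ n])
  qed
qed

lemma principal_sqrt_square:
  assumes S: "S \<in> carrier_mat n n" and pos: "r_positive_definite S"
  shows "principal_sqrt (S * S) = Some S"
proof -
  have "\<not> (l \<in> \<real> \<and> Re l \<le> 0)" if "eigenvalue (S * S) l" for l
  proof
    assume l: "l \<in> \<real> \<and> Re l \<le> 0"
    then obtain x where x: "l = complex_of_real x" "x \<le> 0" by (auto elim: Reals_cases)
    \<comment> \<open>A nonpositive real \<open>l\<close> has purely imaginary square roots, and one
      of them would be an eigenvalue of \<open>S\<close>.\<close>
    have "l = (\<i> * sqrt (- x))\<^sup>2"
      using x by (simp add: power_mult_distrib flip: of_real_power)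
    with eigenvalue_square[OF S, of "\<i> * sqrt (- x)"] that
    have "eigenvalue S (\<i> * sqrt (- x)) \<or> eigenvalue S (- (\<i> * sqrt (- x)))" by simp
    then show False using pos by (auto simp: r_positive_definite_def)
  qed
  moreover have "(THE X. X \<in> carrier_mat n n \<and> X * X = S * S \<and>
      (\<forall>l. eigenvalue X l \<longrightarrow> Re l > 0)) = S"
    using S pos square_root_unique[of _ n S]
    by (intro the_equality) (auto simp: r_positive_definite_def)
  ultimately show ?thesis using S by (simp add: principal_sqrt_def)
qed

section \<open>Invertible matrices and adjoints\<close>

text \<open>\<open>inv_mat\<close> unwraps an option; membership of \<open>A\<close> in the units of
  the matrix ring shows that \<open>mat_inverse\<close> succeeds.\<close>

lemma inv_mat:
  assumes A: "A \<in> carrier_mat n n" and inv: "invertible_mat A"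
  shows "inv_mat A \<in> carrier_mat n n" "A * inv_mat A = 1\<^sub>m n" "inv_mat A * A = 1\<^sub>m n"
proof -
  from inv obtain B where AB: "A * B = 1\<^sub>m n" and BA: "B * A = 1\<^sub>m (dim_row B)"
    using A by (auto simp: invertible_mat_def inverts_mat_def)
  \<comment> \<open>\<open>invertible_mat\<close> does not state the dimensions of the inverse; they
    are recovered from the two product equations.\<close>
  have "dim_col B = n" using arg_cong[OF AB, of dim_col] by simp
  moreover have "dim_row B = n" using arg_cong[OF BA, of dim_col] A by simp
  ultimately have B: "B \<in> carrier_mat n n" by auto
  have "A \<in> Units (ring_mat TYPE(complex) n ())"
    unfolding Units_def ring_mat_def using A B AB BA by auto
  then obtain C where "mat_inverse A = Some C"
    using mat_inverse(1)[OF A, where b = "()"] by (cases "mat_inverse A") auto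
  then show "inv_mat A \<in> carrier_mat n n" "A * inv_mat A = 1\<^sub>m n" "inv_mat A * A = 1\<^sub>m n"
    using mat_inverse(2)[OF A] by (auto simp: inv_mat_def)
qed

lemma invertible_matI:
  fixes A B :: "complex mat"
  assumes "A \<in> carrier_mat n n" "B \<in> carrier_mat n n" "A * B = 1\<^sub>m n"
  shows "invertible_mat A" and "invertible_mat B" and "inv_mat A = B" and "inv_mat B = A"
proof -
  have BA: "B * A = 1\<^sub>m n" by (rule mat_mult_left_right_inverse[OF assms])
  then show inv: "invertible_mat A" "invertible_mat B"
    using assms by (auto simp: invertible_mat_def inverts_mat_def)
  note I = inv_mat[OF assms(1) inv(1)] and J = inv_mat[OF assms(2) inv(2)]
  have "(inv_mat A * A) * B = inv_mat A * (A * B)"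
    by (rule assoc_mult_mat) (use I(1) assms in auto)
  then show "inv_mat A = B" using I assms by simp
  have "(inv_mat B * B) * A = inv_mat B * (B * A)"
    by (rule assoc_mult_mat) (use J(1) assms in auto)
  then show "inv_mat B = A" using J BA assms by simp
qed

text \<open>Both sides are statements about the determinant. This converts spectral information on
  \<Sigma>, \<open>S\<close> and \<open>F\<^sup>[\<^sup>N\<^sup>]F\<close> into
  invertibility.\<close>

lemma invertible_mat_iff_eigenvalue:
  fixes A :: "complex mat"
  assumes A: "A \<in> carrier_mat n n"
  shows "invertible_mat A \<longleftrightarrow> \<not> eigenvalue A 0"
proof -
  have "eigenvalue A 0 \<longleftrightarrow> det A = 0"
    unfolding det_0_iff_vec_prod_zero_field[OF A] eigenvalue_iff[OF A] Bex_def
    by (intro ex_cong1) auto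
  moreover have "det A \<noteq> 0" if "invertible_mat A"
    using det_mult[OF A inv_mat(1)[OF A that]] inv_mat(2)[OF A that] by auto
  moreover have "invertible_mat A" if det: "det A \<noteq> 0"
  proof -
    obtain B where "B \<in> carrier_mat n n" "A * B = 1\<^sub>m n"
      using det_non_zero_imp_unit[OF A det, of "()"] by (auto simp: Units_def ring_mat_def)
    then show ?thesis using invertible_matI(1)[OF A] by blast
  qed
  ultimately show ?thesis by blast
qed

lemma inv_mat_cancel:
  assumes "A \<in> carrier_mat n n" "invertible_mat A" "B \<in> carrier_mat n n"
  shows "A * (inv_mat A * B) = B" "inv_mat A * (A * B) = B"
  using inv_mat[OF assms(1,2)] assms by (simp_all flip: assoc_mult_mat[of _ n n _ n _ n])

lemma inv_mat_mult_distrib: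
  assumes "A \<in> carrier_mat n n" "invertible_mat A" "B \<in> carrier_mat n n" "invertible_mat B"
  shows "inv_mat (A * B) = inv_mat B * inv_mat A" "invertible_mat (A * B)"
proof -
  note I = inv_mat[OF assms(1,2)] inv_mat[OF assms(3,4)]
  have "(A * B) * (inv_mat B * inv_mat A) = 1\<^sub>m n"
    using I assms by (simp add: assoc_mult_mat[of _ n n _ n _ n] inv_mat_cancel[of _ n])
  then show "inv_mat (A * B) = inv_mat B * inv_mat A" "invertible_mat (A * B)"
    using invertible_matI[of "A * B" n "inv_mat B * inv_mat A"] I assms by auto
qed

lemma invertible_inv_mat:
  assumes "A \<in> carrier_mat n n" "invertible_mat A"
  shows "invertible_mat (inv_mat A)" "inv_mat (inv_mat A) = A"
  using invertible_matI[OF assms(1) inv_mat(1,2)[OF assms]] by auto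

section \<open>Conjugation, the star operation, similarity and their spectra\<close>

lemma conj_mat_mult:
  assumes "A \<in> carrier_mat n n" "B \<in> carrier_mat n n"
  shows "conj_mat (A * B) = conj_mat A * conj_mat B"
proof -
  interpret semiring_hom cnj by unfold_locales auto
  show ?thesis using assms by (rule mat_hom_mult)
qed

lemma conj_mat_one: "conj_mat (1\<^sub>m n) = 1\<^sub>m n"
  by (intro eq_matI) auto

lemma star_carrier [simp]: "A \<in> carrier_mat n n \<Longrightarrow> star k A \<in> carrier_mat n n"
  by (cases k) auto

lemma star_mult:
  assumes "A \<in> carrier_mat n n" "B \<in> carrier_mat n n"
  shows "star k (A * B) = star k B * star k A"
  using assms by (cases k) (auto simp: conj_mat_mult[of _ n] transpose_mult[of _ n n _ n])

lemma star_one: "star k (1\<^sub>m n) = 1\<^sub>m n"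
  by (cases k) (auto simp: conj_mat_one)

lemma eigenvalue_conj_mat:
  assumes A: "A \<in> carrier_mat n n" and l: "eigenvalue (conj_mat A) l"
  shows "eigenvalue A (cnj l)"
proof -
  interpret field_hom cnj by unfold_locales auto
  have "conj_mat A \<in> carrier_mat n n" using A by simp
  from eigenvalue_hom[OF this l] have "eigenvalue (conj_mat (conj_mat A)) (cnj l)" .
  moreover have "conj_mat (conj_mat A) = A" by (intro eq_matI) auto
  ultimately show ?thesis by simp
qed

lemma eigenvalue_transpose_mat:
  fixes A :: "complex mat"
  assumes "A \<in> carrier_mat n n"
  shows "eigenvalue (transpose_mat A) l \<longleftrightarrow> eigenvalue A l"
  using assms by (simp add: eigenvalue_root_char_poly[of _ n])

lemma eigenvalue_similar:
  fixes A :: "complex mat"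
  assumes A: "A \<in> carrier_mat n n" and P: "P \<in> carrier_mat n n" "invertible_mat P"
  shows "eigenvalue (inv_mat P * A * P) l \<longleftrightarrow> eigenvalue A l"
proof -
  note I = inv_mat[OF P]
  have "similar_mat (inv_mat P * A * P) A"
    by (rule similar_matI[of _ _ "inv_mat P" P n]) (use A P I in auto)
  then have "char_poly (inv_mat P * A * P) = char_poly A" by (rule char_poly_similar)
  then show ?thesis using A P I by (simp add: eigenvalue_root_char_poly[of _ n])
qed

lemma r_positive_definite_conj_mat:
  assumes "A \<in> carrier_mat n n" "r_positive_definite A"
  shows "r_positive_definite (conj_mat A)"
  using assms eigenvalue_conj_mat[OF assms(1)] by (fastforce simp: r_positive_definite_def)

lemma r_positive_definite_similar:
  assumes "A \<in> carrier_mat n n" "P \<in> carrier_mat n n" "invertible_mat P" "r_positive_definite A"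
  shows "r_positive_definite (inv_mat P * A * P)"
  using assms eigenvalue_similar[OF assms(1-3)] by (simp add: r_positive_definite_def)

lemma r_positive_definite_star:
  assumes A: "A \<in> carrier_mat n n" "r_positive_definite A"
  shows "r_positive_definite (star k A)"
proof (cases k)
  case Bilinear
  then show ?thesis using A by (simp add: r_positive_definite_def eigenvalue_transpose_mat)
next
  case Sesquilinear
  have "conj_mat A \<in> carrier_mat n n" using A by simp
  from eigenvalue_transpose_mat[OF this] show ?thesis
    using r_positive_definite_conj_mat[OF A] Sesquilinear by (simp add: r_positive_definite_def)
qed

section \<open>Matrices with entries in \<open>K\<close>\<close>

lemma mat_over_carrier: "A \<in> mat_over K n \<Longrightarrow> A \<in> carrier_mat n n"
  by (simp add: mat_over_def)

text \<open>With reality expressed as invariance under conjugation, closure under products and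
  inverses follows from multiplicativity of \<open>conj_mat\<close>.\<close>

lemma mat_over_iff:
  assumes "K = \<real> \<or> K = UNIV"
  shows "A \<in> mat_over K n \<longleftrightarrow> A \<in> carrier_mat n n \<and> (K = \<real> \<longrightarrow> conj_mat A = A)"
proof -
  have "elements_mat A \<subseteq> \<real> \<longleftrightarrow> conj_mat A = A"
  proof
    assume *: "elements_mat A \<subseteq> \<real>"
    show "conj_mat A = A"
    proof (rule eq_matI)
      fix i j assume "i < dim_row A" "j < dim_col A"
      then have "A $$ (i, j) \<in> elements_mat A" by (intro elements_matI) auto
      with * \<open>i < dim_row A\<close> \<open>j < dim_col A\<close> show "conj_mat A $$ (i, j) = A $$ (i, j)"
        by (auto simp: Reals_cnj_iff)
    qed auto
  next
    assume *: "conj_mat A = A"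
    show "elements_mat A \<subseteq> \<real>"
    proof
      fix x assume "x \<in> elements_mat A"
      then obtain i j where "i < dim_row A" "j < dim_col A" "x = A $$ (i, j)" by blast
      then show "x \<in> \<real>" using arg_cong[OF *, of "\<lambda>M. M $$ (i, j)"] by (simp add: Reals_cnj_iff)
    qed
  qed
  then show ?thesis using assms by (auto simp: mat_over_def)
qed

lemma mat_over_mult:
  assumes "K = \<real> \<or> K = UNIV" "A \<in> mat_over K n" "B \<in> mat_over K n"
  shows "A * B \<in> mat_over K n"
  using assms by (auto simp: mat_over_iff conj_mat_mult[of _ n])

lemma mat_over_star:
  assumes "K = \<real> \<or> K = UNIV" "A \<in> mat_over K n"
  shows "star k A \<in> mat_over K n"
  using assms by (cases k) (auto simp: mat_over_iff simp flip: map_mat_transpose)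

lemma mat_over_inv_mat:
  assumes K: "K = \<real> \<or> K = UNIV" and A: "A \<in> mat_over K n" "invertible_mat A"
  shows "inv_mat A \<in> mat_over K n"
proof -
  have A': "A \<in> carrier_mat n n" using A by (simp add: mat_over_def)
  note I = inv_mat[OF A' A(2)]
  have "conj_mat (inv_mat A) = inv_mat A" if "K = \<real>"
  proof -
    have "conj_mat A = A" using that A K by (simp add: mat_over_iff)
    then have "A * conj_mat (inv_mat A) = conj_mat (A * inv_mat A)"
      using A' I(1) by (simp add: conj_mat_mult[of _ n])
    also have "\<dots> = 1\<^sub>m n" using I(2) by (simp add: conj_mat_one)
    finally have "inv_mat A = conj_mat (inv_mat A)" by (intro invertible_matI(3)) (use A' I in auto)
    then show ?thesis by simp
  qed
  then show ?thesis using I K by (simp add: mat_over_iff)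
qed

section \<open>Adjoints with respect to a fixed nonsingular \<open>N\<close>\<close>

context
  fixes n :: nat and k :: scalar_product_kind and N :: "complex mat"
  assumes N: "N \<in> carrier_mat n n" and inv_N: "invertible_mat N"
begin

lemmas mat_assoc = assoc_mult_mat[of _ n n _ n _ n] mult_carrier_mat[of _ n n _ n]

lemma adj_carrier: "A \<in> carrier_mat n n \<Longrightarrow> adj k N A \<in> carrier_mat n n"
  using N inv_mat[OF N inv_N] by (auto simp: adj2_def)

text \<open>The inner \<open>N * inv_mat N\<close> cancels. The adjoint need not be an involution,
  but its twofold application is multiplicative, which links the double-adjoint conditions on
  \<open>F\<close> and \<open>W\<close>.\<close>

lemma adj_mult:
  assumes "A \<in> carrier_mat n n" "B \<in> carrier_mat n n"
  shows "adj k N (A * B) = adj k N B * adj k N A"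
  using assms N inv_mat[OF N inv_N]
  by (simp add: adj2_def mat_assoc star_mult[of _ n] inv_mat_cancel[OF N inv_N])

lemma adj_inv_mat:
  assumes A: "A \<in> carrier_mat n n" "invertible_mat A"
  shows "adj k N (inv_mat A) = inv_mat (adj k N A)"
proof -
  note I = inv_mat[OF A]
  have "adj k N A * adj k N (inv_mat A) = adj k N (1\<^sub>m n)"
    using I A by (simp flip: adj_mult)
  also have "\<dots> = 1\<^sub>m n"
    using N inv_mat[OF N inv_N] by (simp add: adj2_def star_one)
  finally show ?thesis
    using invertible_matI(3) adj_carrier A I by metis
qed

text \<open>The adjoint is similar to \<open>star k A\<close>, whose spectrum is that of
  \<open>A\<close> or its complex conjugate.\<close>

lemma r_positive_definite_adj:
  assumes "A \<in> carrier_mat n n" "r_positive_definite A"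
  shows "r_positive_definite (adj k N A)"
  unfolding adj2_def using assms N inv_N
  by (intro r_positive_definite_similar[of _ n] r_positive_definite_star[of _ n]) simp_all

lemma selfadjoint_iff_intertwine:
  assumes "A \<in> carrier_mat n n"
  shows "adj k N A = A \<longleftrightarrow> star k A * N = N * A"
proof
  assume *: "adj k N A = A"
  have "star k A * N = N * adj k N A"
    using assms N inv_mat[OF N inv_N]
    by (simp add: adj2_def mat_assoc inv_mat_cancel[OF N inv_N])
  with * show "star k A * N = N * A" by simp
next
  assume "star k A * N = N * A"
  then show "adj k N A = A"
    using assms N inv_mat[OF N inv_N]
    by (simp add: adj2_def mat_assoc inv_mat_cancel[OF N inv_N])
qed

lemma adj_mat_over:
  assumes "K = \<real> \<or> K = UNIV" "N \<in> mat_over K n" "A \<in> mat_over K n"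
  shows "adj k N A \<in> mat_over K n"
  unfolding adj2_def using assms inv_N by (intro mat_over_mult mat_over_star mat_over_inv_mat)

section \<open>The polar decomposition\<close>

text \<open>The adjoint with respect to \<open>N\<close> and \<open>N * inv_mat Sig\<close> is
  \<open>Sig * adj k N W\<close>, and for square matrices a left inverse is also a right
  inverse.\<close>

lemma unitary2_iff:
  assumes Sig: "Sig \<in> carrier_mat n n" "invertible_mat Sig" and W: "W \<in> carrier_mat n n"
  shows "unitary2 k N (N * inv_mat Sig) W \<longleftrightarrow> Sig * (adj k N W * W) = 1\<^sub>m n"
proof -
  note I = inv_mat[OF N inv_N] inv_mat[OF Sig] invertible_inv_mat[OF Sig]
  have adj2: "adj2 k N (N * inv_mat Sig) W = Sig * adj k N W"
    using N Sig W I inv_mat_mult_distrib[OF N inv_N I(4) I(7)]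
    by (simp add: adj2_def mat_assoc)
  show ?thesis
    using mat_mult_left_right_inverse[of "Sig * adj k N W" n W] Sig W adj_carrier[OF W]
    by (auto simp: unitary2_def adj2 mat_assoc)
qed

text \<open>The adjoint for \<open>N * Sig\<close> is the one for \<open>N\<close> conjugated by
  \<open>Sig\<close>, so the second symmetry of \<open>S\<close> amounts to commutation.\<close>

lemma selfadjoint_mult_iff:
  assumes Sig: "Sig \<in> carrier_mat n n" "invertible_mat Sig" and S: "S \<in> carrier_mat n n"
    and "adj k N S = S"
  shows "selfadjoint k (N * Sig) S \<longleftrightarrow> S * Sig = Sig * S"
proof -
  note I = inv_mat[OF N inv_N] inv_mat[OF Sig]
  have "adj k (N * Sig) S = inv_mat Sig * adj k N S * Sig"
    using N Sig S I inv_mat_mult_distrib[OF N inv_N Sig] by (simp add: adj2_def mat_assoc)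
  then have "selfadjoint k (N * Sig) S \<longleftrightarrow> inv_mat Sig * (S * Sig) = S"
    using assms I by (simp add: selfadjoint_def mat_assoc)
  also have "\<dots> \<longleftrightarrow> S * Sig = Sig * S"
    using inv_mat_cancel[OF Sig] S Sig I by (metis mult_carrier_mat)
  finally show ?thesis .
qed

lemma sign_selfadjoint:
  assumes sgn: "generalized_matrix_sign K n sgm" and A: "A \<in> mat_over K n" "invertible_mat A"
    and K: "K = \<real> \<or> K = UNIV" and self: "adj k N A = A" and Sig: "sgm A = Some Sig"
  shows "adj k N Sig = Sig" "A * Sig = Sig * A"
proof -
  from sgn obtain f where f: "\<And>A. A \<in> mat_over K n \<Longrightarrow> sgm A = primary_matrix_function f A"
    unfolding generalized_matrix_sign_def by blast
  have A': "A \<in> carrier_mat n n" and cA: "conj_mat A \<in> carrier_mat n n"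
    using A by (auto simp: mat_over_def)
  have "conj_mat A \<in> mat_over K n"
    using K A A' by (auto simp: mat_over_iff)
  then have conj: "primary_matrix_function f (conj_mat A) = Some (conj_mat Sig)"
    using sgn A Sig f unfolding generalized_matrix_sign_def by force
  have Sig_f: "primary_matrix_function f A = Some Sig" using f A Sig by simp
  \<comment> \<open>Conjugating a polynomial in \<open>A\<close> would also conjugate its
    coefficients. Interpolating on both spectra makes the same \<open>p\<close> represent the sign
    of \<open>A\<close> and of its conjugate, so \<open>star k Sig\<close> is \<open>p\<close> at
    \<open>star k A\<close> for either kind of product.\<close>
  let ?E = "{l. eigenvalue A l} \<union> {l. eigenvalue (conj_mat A) l}"
  have "?E \<subseteq> dom f"
    using conj Sig_f by (auto simp: primary_matrix_function_def split: if_splits)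
  moreover have "finite ?E" using finite_eigenvalues[OF A'] finite_eigenvalues[OF cA] by simp
  ultimately obtain p where p: "\<And>B. B \<in> carrier_mat n n \<Longrightarrow> (\<And>l. eigenvalue B l \<Longrightarrow> l \<in> ?E) \<Longrightarrow>
      primary_matrix_function f B = Some (mat_poly B p)"
    using primary_matrix_function_interpolation[of ?E f n] by blast
  have Sig_p: "Sig = mat_poly A p" using p[OF A'] Sig_f by simp
  have "conj_mat Sig = mat_poly (conj_mat A) p" using p[OF cA] conj by simp
  then have star: "star k Sig = mat_poly (star k A) p"
    using A' cA by (cases k) (auto simp: Sig_p mat_poly_transpose)
  have "N * A = star k A * N" using self selfadjoint_iff_intertwine[OF A'] by simp
  from mat_poly_intertwine[OF A' star_carrier[OF A'] N this, of p]
  have "star k Sig * N = N * Sig" unfolding star by (simp add: Sig_p)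
  then show "adj k N Sig = Sig"
    using selfadjoint_iff_intertwine[of Sig] A' Sig_p by simp
  show "A * Sig = Sig * A"
    using mat_poly_intertwine[OF A' A' A' refl, of p] by (simp add: Sig_p)
qed

text \<open>The stem function is undefined at 0, so definedness excludes the eigenvalue 0 of
  \<open>A\<close>; the eigenvalues of \<open>Sig\<close> lie on the unit circle.\<close>

lemma generalized_matrix_sign_invertible:
  assumes sgn: "generalized_matrix_sign K n sgm" and A: "A \<in> mat_over K n" "sgm A = Some Sig"
  shows "invertible_mat A" "Sig \<in> mat_over K n" "invertible_mat Sig"
proof -
  have A': "A \<in> carrier_mat n n" using A by (simp add: mat_over_def)
  from sgn obtain f where f: "f 0 = None" "\<And>A. A \<in> mat_over K n \<Longrightarrow> sgm A = primary_matrix_function f A"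
    unfolding generalized_matrix_sign_def by blast
  then have "primary_matrix_function f A = Some Sig" using A by simp
  then have "\<not> eigenvalue A 0" using f(1)
    by (force simp: primary_matrix_function_def split: if_splits)
  then show inv: "invertible_mat A" by (simp add: invertible_mat_iff_eigenvalue[OF A'])
  from sgn A inv have Sig: "Sig \<in> mat_over K n" and "\<forall>l. eigenvalue Sig l \<longrightarrow> cmod l = 1"
    unfolding generalized_matrix_sign_def by force+
  then have "\<not> eigenvalue Sig 0" by force
  with Sig show "Sig \<in> mat_over K n" "invertible_mat Sig"
    by (auto simp: invertible_mat_iff_eigenvalue[OF mat_over_carrier[OF Sig]])
qed

lemma polar_decompositionD:
  assumes K: "K = \<real> \<or> K = UNIV" and N_K: "N \<in> mat_over K n"
    and sgn: "generalized_matrix_sign K n sgm" and F: "F \<in> mat_over K n"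
    and dec: "generalized_polar_decomposition K n k N sgm F W S"
  shows "invertible_mat F" "adj k N (adj k N F) = F" "W = F * inv_mat S"
    "\<exists>Sig. sgm (adj k N F * F) = Some Sig \<and> principal_sqrt (Sig * (adj k N F * F)) = Some S"
proof -
  let ?A = "adj k N F * F"
  from dec obtain Sig where W: "W \<in> carrier_mat n n" and S: "S \<in> carrier_mat n n"
    and F_eq: "F = W * S" and Sig: "sgm ?A = Some Sig"
    and unit: "unitary2 k N (N * inv_mat Sig) W" and WW: "adj k N (adj k N W) = W"
    and pos: "r_positive_definite S" and self: "adj k N S = S"
    and self2: "selfadjoint k (N * Sig) S"
    by (auto simp: generalized_polar_decomposition_def mat_over_def selfadjoint_def)
  have F': "F \<in> carrier_mat n n" using F by (simp add: mat_over_def)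
  have A: "?A \<in> mat_over K n" using K N_K F by (intro mat_over_mult adj_mat_over)
  note G = generalized_matrix_sign_invertible[OF sgn A Sig]
  have Sig': "Sig \<in> carrier_mat n n" and A': "?A \<in> carrier_mat n n"
    using G A by (auto simp: mat_over_def)
  note I = inv_mat[OF A' G(1)]
  have "(inv_mat ?A * adj k N F) * F = 1\<^sub>m n"
    using I F' adj_carrier[OF F'] by (simp add: mat_assoc)
  then show "invertible_mat F"
    using invertible_matI(2)[of "inv_mat ?A * adj k N F" n F] I F' adj_carrier[OF F'] by auto
  have "\<not> eigenvalue S 0" using pos by (auto simp: r_positive_definite_def)
  then have "invertible_mat S" by (simp add: invertible_mat_iff_eigenvalue[OF S])
  then show "W = F * inv_mat S"
    using S W inv_mat[OF S] by (simp add: F_eq mat_assoc)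
  show "adj k N (adj k N F) = F"
    using W S by (simp add: F_eq adj_mult adj_carrier WW self)
  have comm: "S * Sig = Sig * S"
    using self2 selfadjoint_mult_iff[OF Sig' G(3) S self] by simp
  have WU: "Sig * (adj k N W * W) = 1\<^sub>m n"
    using unit unitary2_iff[OF Sig' G(3) W] by simp
  \<comment> \<open>Moving \<open>S\<close> to the left of \<open>Sig\<close> exposes the factor
    that unitarity turns into the identity.\<close>
  have "Sig * ?A = (Sig * S) * (adj k N W * W) * S"
    using W S Sig' by (simp add: F_eq adj_mult adj_carrier self mat_assoc)
  also have "\<dots> = S * (Sig * (adj k N W * W)) * S"
    using W S Sig' adj_carrier[OF W] by (simp add: mat_assoc flip: comm)
  also have "\<dots> = S * S" using S by (simp add: WU)
  finally show "\<exists>Sig. sgm ?A = Some Sig \<and> principal_sqrt (Sig * ?A) = Some S"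
    using Sig principal_sqrt_square[OF S pos] by auto
qed

lemma polar_decomposition_exists:
  assumes K: "K = \<real> \<or> K = UNIV" and N_K: "N \<in> mat_over K n"
    and sgn: "generalized_matrix_sign K n sgm" and F: "F \<in> mat_over K n"
    and inv_F: "invertible_mat F" and FF: "adj k N (adj k N F) = F"
  shows "\<exists>W S. generalized_polar_decomposition K n k N sgm F W S"
proof -
  define A where "A = adj k N F * F"
  have F': "F \<in> carrier_mat n n" using F by (simp add: mat_over_def)
  have A: "A \<in> mat_over K n" unfolding A_def using K N_K F by (intro mat_over_mult adj_mat_over)
  then have A': "A \<in> carrier_mat n n" by (simp add: mat_over_def)
  have inv_A: "invertible_mat A"
  proof -
    have "adj k N (inv_mat F) * adj k N F = adj k N (F * inv_mat F)"
      using F' inv_mat(1)[OF F' inv_F] by (simp add: adj_mult)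
    also have "\<dots> = 1\<^sub>m n"
      using N inv_mat[OF N inv_N] inv_mat[OF F' inv_F] by (simp add: adj2_def star_one)
    finally have "invertible_mat (adj k N F)"
      using invertible_matI(2) adj_carrier F' inv_mat(1)[OF F' inv_F] by blast
    then show ?thesis
      unfolding A_def using inv_mat_mult_distrib(2) adj_carrier F' inv_F by blast
  qed
  from sgn A inv_A obtain Sig where Sig: "sgm A = Some Sig" "Sig \<in> mat_over K n"
    and neg: "\<And>l. eigenvalue (Sig * A) l \<Longrightarrow> \<not> (l \<in> \<real> \<and> Re l < 0)"
    unfolding generalized_matrix_sign_def by blast
  have Sig': "Sig \<in> carrier_mat n n" using Sig by (simp add: mat_over_def)
  note inv_Sig = generalized_matrix_sign_invertible(3)[OF sgn A Sig(1)]
  note ISig = inv_mat[OF Sig' inv_Sig]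
  \<comment> \<open>The double-adjoint condition on \<open>F\<close> enters here.\<close>
  have self_A: "adj k N A = A"
    using F' by (simp add: A_def adj_mult adj_carrier FF)
  note SA = sign_selfadjoint[OF sgn A inv_A K self_A Sig(1)]
  define M where "M = Sig * A"
  have M: "M \<in> mat_over K n" unfolding M_def using K Sig(2) A by (rule mat_over_mult)
  then have M': "M \<in> carrier_mat n n" by (simp add: mat_over_def)
  have "invertible_mat M"
    unfolding M_def using inv_mat_mult_distrib(2)[OF Sig' inv_Sig A' inv_A] .
  then have "\<not> eigenvalue M 0" by (simp add: invertible_mat_iff_eigenvalue[OF M'])
  \<comment> \<open>The sign function excludes only the open negative axis; 0 is excluded by
    invertibility of \<open>M\<close>.\<close>
  have "\<not> (l \<in> \<real> \<and> Re l \<le> 0)" if l: "eigenvalue M l" for l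
  proof -
    have "l \<noteq> 0" using l \<open>\<not> eigenvalue M 0\<close> by auto
    then show ?thesis using neg[of l] l by (auto simp: M_def complex_eq_iff complex_is_Real_iff)
  qed
  then obtain S where S: "S \<in> carrier_mat n n" and SS: "S * S = M" and pos: "r_positive_definite S"
    using square_root_exists[OF M'] by blast
  have S_unique: "X = S" if "X \<in> carrier_mat n n" "r_positive_definite X" "X * X = M" for X
    using square_root_unique[of X n S] that S SS pos by simp
  have self_S: "adj k N S = S"
  proof (rule S_unique)
    \<comment> \<open>The adjoint of \<open>Sig * A\<close> is \<open>A * Sig\<close>, which equals
      \<open>M\<close> because the two commute.\<close>
    show "adj k N S * adj k N S = M"
      using S A' Sig' SA by (simp add: SS M_def self_A adj_mult flip: adj_mult[OF S S])
  qed (use S pos adj_carrier r_positive_definite_adj in auto)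
  have "conj_mat S = S" if "K = \<real>"
  proof (rule S_unique)
    have "conj_mat M = M" using M K that by (simp add: mat_over_iff)
    then show "conj_mat S * conj_mat S = M"
      using S by (simp add: SS flip: conj_mat_mult)
  qed (use S pos r_positive_definite_conj_mat in auto)
  then have S_K: "S \<in> mat_over K n" using S K by (simp add: mat_over_iff)
  \<comment> \<open>Commutation is proved in the form of a similarity, which preserves the spectrum
    and fixes \<open>M\<close>, so that uniqueness of the root applies.\<close>
  have pos_conj: "r_positive_definite (inv_mat Sig * S * Sig)"
    by (rule r_positive_definite_similar[OF S Sig' inv_Sig pos])
  have "inv_mat Sig * S * Sig = S"
  proof (rule S_unique)
    have "(inv_mat Sig * S * Sig) * (inv_mat Sig * S * Sig) = inv_mat Sig * (S * S) * Sig"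
      using S Sig' ISig by (simp add: mat_assoc inv_mat_cancel[OF Sig' inv_Sig])
    also have "\<dots> = M"
      using A' Sig' ISig SA(2) by (simp add: SS M_def mat_assoc inv_mat_cancel[OF Sig' inv_Sig])
    finally show "(inv_mat Sig * S * Sig) * (inv_mat Sig * S * Sig) = M" .
  qed (use S Sig' ISig pos_conj in auto)
  then have "Sig * (inv_mat Sig * (S * Sig)) = Sig * S"
    using S Sig' ISig by (simp add: mat_assoc)
  then have comm: "S * Sig = Sig * S"
    using S Sig' by (simp add: inv_mat_cancel[OF Sig' inv_Sig])
  have "\<not> eigenvalue S 0" using pos by (auto simp: r_positive_definite_def)
  then have inv_S: "invertible_mat S" by (simp add: invertible_mat_iff_eigenvalue[OF S])
  note IS = inv_mat[OF S inv_S]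
  define W where "W = F * inv_mat S"
  have W: "W \<in> carrier_mat n n" using F' IS by (simp add: W_def)
  have adj_IS: "adj k N (inv_mat S) = inv_mat S"
    using adj_inv_mat[OF S inv_S] self_S by simp
  have comm_IS: "Sig * inv_mat S = inv_mat S * Sig"
  proof -
    have "inv_mat S * (S * Sig) * inv_mat S = inv_mat S * (Sig * S) * inv_mat S" by (simp add: comm)
    then show ?thesis using S Sig' IS by (simp add: mat_assoc inv_mat_cancel[OF S inv_S])
  qed
  \<comment> \<open>The inverse of \<open>S\<close> is self-adjoint and commutes with
    \<open>Sig\<close>, so the product reduces to \<open>M\<close> between two inverses of
    \<open>S\<close>.\<close>
  have "Sig * (adj k N W * W) = (Sig * inv_mat S) * A * inv_mat S"
    using F' IS Sig' adj_carrier[OF F'] by (simp add: W_def A_def adj_mult adj_IS mat_assoc)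
  also have "\<dots> = inv_mat S * M * inv_mat S"
    using A' IS Sig' by (simp add: comm_IS M_def mat_assoc)
  also have "\<dots> = 1\<^sub>m n"
    using S IS by (simp add: mat_assoc inv_mat_cancel[OF S inv_S] flip: SS)
  finally have "unitary2 k N (N * inv_mat Sig) W"
    using unitary2_iff[OF Sig' inv_Sig W] by simp
  moreover have "adj k N (adj k N W) = W"
    using F' IS by (simp add: W_def adj_mult adj_carrier adj_IS FF)
  moreover have "selfadjoint k (N * Sig) S"
    using selfadjoint_mult_iff[OF Sig' inv_Sig S self_S] comm by simp
  moreover have "F = W * S"
    using F' S IS by (simp add: W_def mat_assoc)
  moreover have "W \<in> mat_over K n"
    unfolding W_def using K F S_K inv_S by (intro mat_over_mult mat_over_inv_mat)
  ultimately have "generalized_polar_decomposition K n k N sgm F W S"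
    using S_K pos self_S Sig(1)
    by (auto simp: generalized_polar_decomposition_def selfadjoint_def A_def)
  then show ?thesis by blast
qed

end

theorem theorem4p1:
  fixes K :: "complex set" and n :: nat and k :: scalar_product_kind
    and N F :: "complex mat" and sgm :: "complex mat \<rightharpoonup> complex mat"
  assumes "K = \<real> \<or> K = UNIV"
    and "N \<in> mat_over K n" and "invertible_mat N"
    and "generalized_matrix_sign K n sgm"
    and "F \<in> mat_over K n"
  shows "((\<exists>W S. generalized_polar_decomposition K n k N sgm F W S) \<longleftrightarrow>
            invertible_mat F \<and> adj k N (adj k N F) = F) \<and>
         ((\<exists>W S. generalized_polar_decomposition K n k N sgm F W S) \<longrightarrow>
            (\<exists>!(W, S). generalized_polar_decomposition K n k N sgm F W S)) \<and>
         (\<forall>W S. generalized_polar_decomposition K n k N sgm F W S \<longrightarrow>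
            (\<exists>Sig. sgm (adj k N F * F) = Some Sig \<and>
               principal_sqrt (Sig * (adj k N F * F)) = Some S) \<and>
            W = F * inv_mat S)"
proof -
  note N = mat_over_carrier[OF assms(2)]
  note D = polar_decompositionD[OF N assms(3) assms(1,2,4,5)]
  note E = polar_decomposition_exists[OF N assms(3) assms(1,2,4,5)]
  have unique: "W = W' \<and> S = S'"
    if "generalized_polar_decomposition K n k N sgm F W S"
      "generalized_polar_decomposition K n k N sgm F W' S'" for W S W' S'
  proof -
    \<comment> \<open>\<open>Sig\<close> depends only on \<open>F\<close>, and
      \<open>principal_sqrt\<close> is a function, so \<open>S\<close> is determined and with it
      \<open>W\<close>.\<close>
    have "S = S'" using D(4)[OF that(1)] D(4)[OF that(2)] by auto
    then show ?thesis using D(3)[OF that(1)] D(3)[OF that(2)] by simp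
  qed
  show ?thesis
  proof (intro conjI allI impI)
    show "(\<exists>W S. generalized_polar_decomposition K n k N sgm F W S) \<longleftrightarrow>
        invertible_mat F \<and> adj k N (adj k N F) = F"
      using D(1,2) E by blast
  next
    assume "\<exists>W S. generalized_polar_decomposition K n k N sgm F W S"
    then obtain W S where "generalized_polar_decomposition K n k N sgm F W S" by blast
    then show "\<exists>!(W, S). generalized_polar_decomposition K n k N sgm F W S"
      using unique by (intro ex1I[of _ "(W, S)"]) auto
  qed (use D(3,4) in blast)+
qed

end
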